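(* Let $\nu$ be a lattice path from $(0,0)$ to $(b,a)$. The map $\varphi:\mathcal{T}_\nu\rightarrow\mathcal{P}_\nu$ is a bijection between the set $\mathcal{T}_\nu$ of $\nu$-Schröder trees and the set $\mathcal{P}_\nu$ of $\nu$-Schröder paths.
   Context: A lattice path from $(0,0)$ to $(b,a)\in\mathbb{Z}_{\ge0}^2$ is a sequence of $a$ north steps $N=(0,1)$ and $b$ east steps $E=(1,0)$. A $\nu$-Schröder path is a path from $(0,0)$ to $(b,a)$ with steps $N$, $E$, $D=(1,1)$ which stays weakly above $\nu$. $R_\nu$ is the region weakly above $\nu$ inside the rectangle with corners $(0,0)$ and $(b,a)$. Two lattice points $p,q$ in $R_\nu$ are $\nu$-incompatible if $p$ is strictly southwest or strictly northeast of $q$ (both coordinates differ) and the smallest rectangle containing $p$ and $q$ is contained in $R_\nu$; otherwise they are $\nu$-compatible. A $\nu$-Schröder tree is a set $T$ of pairwise $\nu$-compatible lattice points in $R_\nu$ which includes the point $(0,a)$ (the root) and such that each of the $a+1$ rows and each of the $b+1$ columns of the grid contains at least one point of $T$. Labels: each non-root point $p$ of $T$ receives the label $N$ if $T$ has a point above $p$ in the same column, $E$ if $T$ has a point to the left of $p$ in the same row, and $D$ if neither holds ($\nu$-compatibility guarantees that the first two cases do not both occur). (Equivalently, in the plane tree associated with $T$, the label records whether the parent of $p$ lies in the same column, the same row, or neither.) The map $\varphi$: list the non-root points of $T$ row by row from bottom to top and within each row from right to left (equivalently, in counterclockwise post-order of the tree). Then $\varphi(T)$ is the path starting at $(0,0)$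 whose sequence of steps is the sequence of labels in this order. *)

theory Defs
  imports "HOL-Analysis.Analysis"
begin

datatype step = North | East | Diag

fun dir :: "step \<Rightarrow> nat \<times> nat" where
  "dir North = (0, 1)"
| "dir East = (1, 0)"
| "dir Diag = (1, 1)"

text \<open>A path is given by its sequence of steps; it always starts at the origin.\<close>

definition endpoint :: "step list \<Rightarrow> nat \<times> nat" where
  "endpoint w = sum_list (map dir w)"

definition lattice_path :: "step list \<Rightarrow> bool" where
  "lattice_path \<nu> \<longleftrightarrow> set \<nu> \<subseteq> {North, East}"

abbreviation width :: "step list \<Rightarrow> nat" where
  "width \<nu> \<equiv> fst (endpoint \<nu>)"

abbreviation height :: "step list \<Rightarrow> nat" where
  "height \<nu> \<equiv> snd (endpoint \<nu>)"

definition embed :: "nat \<times> nat \<Rightarrow> real \<times> real" where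
  "embed p = (real (fst p), real (snd p))"

fun trace_from :: "nat \<times> nat \<Rightarrow> step list \<Rightarrow> (real \<times> real) set" where
  "trace_from p [] = {embed p}"
| "trace_from p (s # w) =
     closed_segment (embed p) (embed (p + dir s)) \<union> trace_from (p + dir s) w"

definition trace :: "step list \<Rightarrow> (real \<times> real) set" where
  "trace w = trace_from (0, 0) w"

text \<open>The region is a subset of the real plane, not a set of lattice points: a diagonal step
  across a corner North, East of \<open>\<nu>\<close> has both of its endpoints on \<open>\<nu>\<close>, but does not stay
  weakly above \<open>\<nu>\<close>.\<close>

definition region :: "step list \<Rightarrow> (real \<times> real) set" where
  "region \<nu> = {(x, y). 0 \<le> x \<and> x \<le> real (width \<nu>) \<and> 0 \<le> y \<and> y \<le> real (height \<nu>) \<and>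
     (\<exists>y'. (x, y') \<in> trace \<nu> \<and> y' \<le> y)}"

definition schroeder_paths :: "step list \<Rightarrow> step list set" where
  "schroeder_paths \<nu> = {\<mu>. endpoint \<mu> = endpoint \<nu> \<and> trace \<mu> \<subseteq> region \<nu>}"

definition strictly_southwest :: "nat \<times> nat \<Rightarrow> nat \<times> nat \<Rightarrow> bool" where
  "strictly_southwest p q \<longleftrightarrow> fst p < fst q \<and> snd p < snd q"

definition rectangle :: "nat \<times> nat \<Rightarrow> nat \<times> nat \<Rightarrow> (real \<times> real) set" where
  "rectangle p q =
     {real (min (fst p) (fst q)) .. real (max (fst p) (fst q))} \<times>
     {real (min (snd p) (snd q)) .. real (max (snd p) (snd q))}"

definition incompatible :: "step list \<Rightarrow> nat \<times> nat \<Rightarrow> nat \<times> nat \<Rightarrow> bool" where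
  "incompatible \<nu> p q \<longleftrightarrow>
     (strictly_southwest p q \<or> strictly_southwest q p) \<and> rectangle p q \<subseteq> region \<nu>"

definition root :: "step list \<Rightarrow> nat \<times> nat" where
  "root \<nu> = (0, height \<nu>)"

definition schroeder_trees :: "step list \<Rightarrow> (nat \<times> nat) set set" where
  "schroeder_trees \<nu> = {T.
     (\<forall>p\<in>T. embed p \<in> region \<nu>) \<and>
     pairwise (\<lambda>p q. \<not> incompatible \<nu> p q) T \<and>
     root \<nu> \<in> T \<and>
     (\<forall>y\<le>height \<nu>. \<exists>x. (x, y) \<in> T) \<and>
     (\<forall>x\<le>width \<nu>. \<exists>y. (x, y) \<in> T)}"

text \<open>The order of the cases is immaterial for trees: compatibility excludes that a point of a
  tree has both a point above it and a point to its left.\<close>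

definition label :: "(nat \<times> nat) set \<Rightarrow> nat \<times> nat \<Rightarrow> step" where
  "label T p =
     (if \<exists>y. snd p < y \<and> (fst p, y) \<in> T then North
      else if \<exists>x. x < fst p \<and> (x, snd p) \<in> T then East
      else Diag)"

definition nonroot_points :: "step list \<Rightarrow> (nat \<times> nat) set \<Rightarrow> (nat \<times> nat) list" where
  "nonroot_points \<nu> T =
     [(x, y). y \<leftarrow> [0..<Suc (height \<nu>)], x \<leftarrow> rev [0..<Suc (width \<nu>)], (x, y) \<in> T - {root \<nu>}]"

definition \<phi> :: "step list \<Rightarrow> (nat \<times> nat) set \<Rightarrow> step list" where
  "\<phi> \<nu> T = map (label T) (nonroot_points \<nu> T)"

end

theory Submission
  imports Defs
begin

text \<open>
  Write \<open>r y\<close> for the abscissa of the last point of \<open>\<nu>\<close> in row \<open>y\<close>. Compatibility says that the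
  first point of a tree in the reading order, which lies in row \<open>y\<close>, is in the rightmost column
  \<open>x \<le> r y\<close>: otherwise the point of the tree in that column lies above row \<open>y\<close> and is incompatible
  with the first point. Removing the first point leaves a partial tree of the same kind that avoids
  the set \<open>C\<close> of exhausted columns (those whose top point, labelled East or Diag, was removed), and
  again its first point is in the rightmost column \<open>x \<le> r y\<close> outside \<open>C\<close>. So a tree is rebuilt from
  its word step by step. At each step the path stands at \<open>(card C, y)\<close>, so the column
  found is not column 0, and hence may be exhausted, iff \<open>card C < r y\<close>; this is the condition that
  an East or Diag step stays weakly above \<open>\<nu>\<close>.
\<close>

section \<open>Trees and words over a staircase\<close>

text \<open>The reading order of \<phi>: upward by rows, from right to left within a row.\<close>

definition before :: "nat \<times> nat \<Rightarrow> nat \<times> nat \<Rightarrow> bool" where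
  "before p q \<longleftrightarrow> snd p < snd q \<or> snd p = snd q \<and> fst q < fst p"

text \<open>The label North promises another point higher in the column; any other label marks the
  top point of its column, which then cannot be met again.\<close>

definition exhaust :: "step \<Rightarrow> nat \<Rightarrow> nat set \<Rightarrow> nat set" where
  "exhaust s x C = (if s = North then C else insert x C)"

text \<open>Only the label East promises another point of the same row, further left and hence still
  unread. After any other label the row is finished.\<close>

definition next_row :: "step \<Rightarrow> nat \<Rightarrow> nat" where
  "next_row s y = (if s = East then y else Suc y)"

definition grid :: "nat \<Rightarrow> nat \<Rightarrow> (nat \<times> nat) list" where
  "grid a b = concat (map (\<lambda>y. map (\<lambda>x. (x, y)) (rev [0..<Suc b])) [0..<Suc a])"

text \<open>This is \<phi> in terms of the dimensions alone, so that it also applies to what remains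
  of a tree after some points have been read.\<close>

definition tree_word :: "nat \<Rightarrow> nat \<Rightarrow> (nat \<times> nat) set \<Rightarrow> step list" where
  "tree_word a b T = map (label T) (filter (\<lambda>p. p \<in> T - {(0, a)}) (grid a b))"

lemma set_grid: "set (grid a b) = {..b} \<times> {..a}"
  unfolding grid_def by (auto simp: less_Suc_eq_le simp del: upt_Suc)

lemma sorted_wrt_before_grid: "sorted_wrt before (grid a b)"
proof (induction a)
  have row: "sorted_wrt before (map (\<lambda>x. (x, y)) (rev [0..<n]))" for n y
    by (induction n) (auto simp: before_def)
  {
    case 0
    show ?case using row[of 0 "Suc b"] by (simp add: grid_def)
  next
    case (Suc a)
    have "grid (Suc a) b = grid a b @ map (\<lambda>x. (x, Suc a)) (rev [0..<Suc b])"
      by (simp add: grid_def)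
    moreover have "before p q"
      if "p \<in> set (grid a b)" "q \<in> set (map (\<lambda>x. (x, Suc a)) (rev [0..<Suc b]))" for p q
      using that by (auto simp: set_grid before_def simp del: upt_Suc)
    ultimately show ?case
      using Suc row[of "Suc a" "Suc b"] by (simp only: sorted_wrt_append) blast
  }
qed

lemma filter_sorted_wrt_first:
  assumes "sorted_wrt R xs" "\<And>x. \<not> R x x" "\<And>x y. R x y \<Longrightarrow> \<not> R y x"
    and "p \<in> set xs" "P p" "\<And>q. P q \<Longrightarrow> q \<noteq> p \<Longrightarrow> R p q"
  shows "filter P xs = p # filter (\<lambda>q. P q \<and> q \<noteq> p) xs"
  using assms(1,4)
proof (induction xs)
  case (Cons x xs)
  show ?case
  proof (cases "x = p")
    case True
    then have "p \<notin> set xs" using Cons.prems assms(2) by auto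
    then have "filter P xs = filter (\<lambda>q. P q \<and> q \<noteq> p) xs" by (intro filter_cong) auto
    then show ?thesis using True assms(5) by simp
  next
    case False
    \<comment> \<open>Here \<open>R x p\<close> because \<open>x\<close> stands earlier in the list;
      if \<open>P x\<close> held, then also \<open>R p x\<close>, against asymmetry.\<close>
    then have "\<not> P x" using Cons.prems assms(3,6) by auto
    then show ?thesis using Cons False by auto
  qed
qed simp

text \<open>Deleting the first point changes no other label: a point read earlier is never above
  another one in its column nor to the left of one in its row.\<close>

lemma tree_word_first:
  assumes "p \<in> T" "p \<in> set (grid a b)" "p \<noteq> (0, a)"
    and first: "\<And>q. q \<in> T - {p} \<Longrightarrow> before p q"
  shows "tree_word a b T = label T p # tree_word a b (T - {p})"
proof -
  have "filter (\<lambda>q. q \<in> T - {(0, a)}) (grid a b)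
      = p # filter (\<lambda>q. q \<in> T - {(0, a)} \<and> q \<noteq> p) (grid a b)"
    by (rule filter_sorted_wrt_first[where R = before])
      (use assms sorted_wrt_before_grid in \<open>auto simp: before_def\<close>)
  moreover have "(\<lambda>q. q \<in> T - {(0, a)} \<and> q \<noteq> p) = (\<lambda>q. q \<in> T - {p} - {(0, a)})"
    by auto
  moreover have "label T q = label (T - {p}) q" if "q \<in> T - {p}" for q
  proof -
    have *: "before p q" using that first by blast
    have "(\<exists>y. snd q < y \<and> (fst q, y) \<in> T) \<longleftrightarrow> (\<exists>y. snd q < y \<and> (fst q, y) \<in> T - {p})"
      using * by (auto simp: before_def)
    moreover have "(\<exists>x. x < fst q \<and> (x, snd q) \<in> T) \<longleftrightarrow> (\<exists>x. x < fst q \<and> (x, snd q) \<in> T - {p})"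
      using * by (auto simp: before_def)
    ultimately show ?thesis unfolding label_def by (simp only:)
  qed
  ultimately show ?thesis by (simp add: tree_word_def)
qed

text \<open>The combinatorial content of \<nu>: \<open>r y\<close> is the last column available in
  row \<open>y\<close>, \<open>a\<close> is the top row and \<open>b\<close> the last
  column.\<close>

locale staircase =
  fixes r :: "nat \<Rightarrow> nat" and a b :: nat
  assumes r_mono: "y \<le> y' \<Longrightarrow> y' \<le> a \<Longrightarrow> r y \<le> r y'"
    and r_top: "r a = b"
begin

text \<open>The pair \<open>(c, y)\<close> is the current point of the path. A diagonal step is
  tested in the row it leaves, because it must not cut below a corner of \<nu>.\<close>

fun word_above :: "nat \<Rightarrow> nat \<Rightarrow> step list \<Rightarrow> bool" where
  "word_above c y [] \<longleftrightarrow> c = b \<and> y = a"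
| "word_above c y (s # w) \<longleftrightarrow> (s \<noteq> East \<longrightarrow> y < a) \<and> (s \<noteq> North \<longrightarrow> c < r y) \<and>
     word_above (if s = North then c else Suc c) (next_row s y) w"

text \<open>What remains of a tree when rows below \<open>y\<close> are finished and the columns in
  \<open>C\<close> are exhausted. Compatibility is expressed by the lower right corner
  \<open>(x', z)\<close> of the rectangle lying outside the region.\<close>

definition partial_trees :: "nat set \<Rightarrow> nat \<Rightarrow> (nat \<times> nat) set set" where
  "partial_trees C y = {T.
     (\<forall>x z. (x, z) \<in> T \<longrightarrow> y \<le> z \<and> z \<le> a \<and> x \<le> r z \<and> x \<notin> C) \<and>
     (\<forall>x z x' z'. (x, z) \<in> T \<longrightarrow> (x', z') \<in> T \<longrightarrow> x < x' \<longrightarrow> z < z' \<longrightarrow> r z < x') \<and>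
     (0, a) \<in> T \<and>
     (\<forall>z. y \<le> z \<longrightarrow> z \<le> a \<longrightarrow> (\<exists>x. (x, z) \<in> T)) \<and>
     (\<forall>x\<le>b. x \<notin> C \<longrightarrow> (\<exists>z. (x, z) \<in> T))}"

text \<open>Column 0 is excluded: its top point is the root, which is never read. The columns
  exhausted so far were found in rows up to \<open>y\<close>, hence the bound
  \<open>r y\<close>.\<close>

definition exhaustible :: "nat set \<Rightarrow> nat \<Rightarrow> bool" where
  "exhaustible C y \<longleftrightarrow> C \<subseteq> {1..r y} \<and> y \<le> a"

definition free_column :: "nat set \<Rightarrow> nat \<Rightarrow> nat" where
  "free_column C y = Max ({..r y} - C)"

lemma r_le: "y \<le> a \<Longrightarrow> r y \<le> b"
  using r_mono[of y a] r_top by simp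

lemma partial_treesD:
  assumes "T \<in> partial_trees C y"
  shows "(x, z) \<in> T \<Longrightarrow> y \<le> z" "(x, z) \<in> T \<Longrightarrow> z \<le> a" "(x, z) \<in> T \<Longrightarrow> x \<le> r z"
    "(x, z) \<in> T \<Longrightarrow> x \<notin> C"
    "(x, z) \<in> T \<Longrightarrow> (x', z') \<in> T \<Longrightarrow> x < x' \<Longrightarrow> z < z' \<Longrightarrow> r z < x'"
    "(0, a) \<in> T"
    "y \<le> z \<Longrightarrow> z \<le> a \<Longrightarrow> \<exists>x. (x, z) \<in> T"
    "x \<le> b \<Longrightarrow> x \<notin> C \<Longrightarrow> \<exists>z. (x, z) \<in> T"
  using assms unfolding partial_trees_def by blast+

lemma free_column:
  assumes "exhaustible C y"
  shows "free_column C y \<le> r y" "free_column C y \<notin> C"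
    "x \<le> r y \<Longrightarrow> x \<notin> C \<Longrightarrow> x \<le> free_column C y"
proof -
  have "0 \<in> {..r y} - C" using assms by (auto simp: exhaustible_def)
  then have "free_column C y \<in> {..r y} - C"
    unfolding free_column_def by (intro Max_in) auto
  then show "free_column C y \<le> r y" "free_column C y \<notin> C" by auto
  show "x \<le> free_column C y" if "x \<le> r y" "x \<notin> C"
    unfolding free_column_def using that by (intro Max_ge) auto
qed

text \<open>A pigeonhole count within \<open>{1..r y}\<close>, which contains \<open>C\<close>. This
  is where the column of a tree point is tied to the position of the path.\<close>

lemma free_column_pos_iff:
  assumes "exhaustible C y"
  shows "0 < free_column C y \<longleftrightarrow> card C < r y"
proof
  have C: "C \<subseteq> {1..r y}" using assms by (simp add: exhaustible_def)
  show "card C < r y" if "0 < free_column C y"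
  proof -
    have "free_column C y \<in> {1..r y} - C" using that free_column[OF assms] by auto
    then have "C \<subset> {1..r y}" using C by blast
    then have "card C < card {1..r y}" by (intro psubset_card_mono) auto
    then show ?thesis by simp
  qed
  show "0 < free_column C y" if "card C < r y"
  proof -
    have "\<not> {1..r y} \<subseteq> C"
      using that card_mono[of C "{1..r y}"] finite_subset[OF C] by auto
    then obtain x where "1 \<le> x" "x \<le> r y" "x \<notin> C" by (meson atLeastAtMost_iff subsetI)
    then show ?thesis using free_column(3)[OF assms, of x] by auto
  qed
qed

text \<open>If a column is exhausted, the count shows it is not column 0; passing to the next row
  can only enlarge the bound, by monotonicity of \<open>r\<close>.\<close>

lemma exhaustible_next:
  assumes "exhaustible C y" "s \<noteq> East \<Longrightarrow> y < a" "s \<noteq> North \<Longrightarrow> card C < r y"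
  shows "exhaustible (exhaust s (free_column C y) C) (next_row s y)"
proof -
  have "r y \<le> r (next_row s y)" "next_row s y \<le> a"
    using assms(1,2) r_mono[of y "Suc y"] by (auto simp: next_row_def exhaustible_def)
  moreover have "exhaust s (free_column C y) C \<subseteq> {1..r y}"
    using assms(1,3) free_column(1)[OF assms(1)] free_column_pos_iff[OF assms(1)]
    by (auto simp: exhaust_def exhaustible_def)
  ultimately show ?thesis by (auto simp: exhaustible_def)
qed

lemma card_exhaust:
  assumes "exhaustible C y"
  shows "card (exhaust s (free_column C y) C) = (if s = North then card C else Suc (card C))"
proof -
  have "finite C" using assms finite_subset by (auto simp: exhaustible_def)
  then show ?thesis using free_column(2)[OF assms] by (simp add: exhaust_def)
qed

section \<open>Removing and inserting the first point\<close>

lemma partial_tree_first: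
  assumes C: "exhaustible C y" and T: "T \<in> partial_trees C y"
  defines "x \<equiv> free_column C y"
  shows "(x, y) \<in> T" "q \<in> T - {(x, y)} \<Longrightarrow> before (x, y) q"
proof -
  note TD = partial_treesD[OF T] and x = free_column[OF C, folded x_def]
  have "y \<le> a" using C by (simp add: exhaustible_def)
  then obtain u where u: "(u, y) \<in> T" using TD(7)[of y] by auto
  then have "u \<le> x" using x(3) TD(3,4) by blast
  obtain z where z: "(x, z) \<in> T"
    using TD(8)[of x] x(1,2) r_le[OF \<open>y \<le> a\<close>] by auto
  show "(x, y) \<in> T"
  proof (rule ccontr)
    assume "(x, y) \<notin> T"
    \<comment> \<open>Now \<open>(u, y)\<close> is strictly southwest of \<open>(x, z)\<close>,
      while the corner \<open>(x, y)\<close> is in the region because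
      \<open>x \<le> r y\<close>.\<close>
    then have "u < x" "y < z" using u z \<open>u \<le> x\<close> TD(1)[OF z] by (metis le_neq_implies_less)+
    then show False using TD(5)[OF u z] x(1) by simp
  qed
  show "before (x, y) q" if "q \<in> T - {(x, y)}"
  proof -
    obtain x' y' where q: "q = (x', y')" by (cases q)
    then have q': "(x', y') \<in> T" "(x', y') \<noteq> (x, y)" using that by auto
    \<comment> \<open>A point of row \<open>y\<close> has its column at most \<open>r y\<close> and
      outside \<open>C\<close>, so it is not to the right of the maximum \<open>x\<close>.\<close>
    show ?thesis
      using TD(1)[OF q'(1)] TD(3)[OF q'(1)] TD(4)[OF q'(1)] x(3)[of x'] q'(2)
      unfolding q before_def by (cases "y' = y") auto
  qed
qed

lemma partial_tree_remove_first:
  assumes C: "exhaustible C y" and T: "T \<in> partial_trees C y" and ne: "T \<noteq> {(0, a)}"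
  defines "x \<equiv> free_column C y"
  defines "s \<equiv> label T (x, y)"
  shows "(x, y) \<noteq> (0, a)" "s \<noteq> East \<Longrightarrow> y < a" "s \<noteq> North \<Longrightarrow> card C < r y"
    "T - {(x, y)} \<in> partial_trees (exhaust s x C) (next_row s y)"
proof -
  note TD = partial_treesD[OF T] and x = free_column[OF C, folded x_def]
    and first = partial_tree_first[OF C T, folded x_def]
  have ya: "y \<le> a" using C by (simp add: exhaustible_def)
  show nr: "(x, y) \<noteq> (0, a)"
  proof
    assume *: "(x, y) = (0, a)"
    \<comment> \<open>Only the top row is left, and its rightmost free column is 0, so no other
      point fits.\<close>
    have "q = (0, a)" if "q \<in> T" for q
    proof -
      obtain x' y' where q: "q = (x', y')" by (cases q)
      then have "(x', y') \<in> T" using that by simp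
      from TD(1-4)[OF this] x(3)[of x'] * show ?thesis by (auto simp: q)
    qed
    then show False using ne TD(6) by blast
  qed
  \<comment> \<open>The root is the witness both times: left of the first point in the top row,
    above it in column 0.\<close>
  have left: "\<exists>u<x. (u, y) \<in> T" if "y = a"
    using nr TD(6) that by auto
  have above: "\<exists>z>y. (x, z) \<in> T" if "x = 0"
    using nr TD(6) that ya by (auto intro: le_neq_implies_less)
  \<comment> \<open>A point to the left and a point above would be incompatible, with the first
    point as the lower right corner of their rectangle.\<close>
  have not_both: False if "u < x" "(u, y) \<in> T" "y < z" "(x, z) \<in> T" for u z
    using TD(5)[OF that(2,4,1,3)] x(1) by simp
  have N: "s = North \<longleftrightarrow> (\<exists>z>y. (x, z) \<in> T)"
    and E: "s = East \<longleftrightarrow> (\<exists>u<x. (u, y) \<in> T)"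
    using not_both unfolding s_def label_def by auto
  show "y < a" if "s \<noteq> East"
    using that E left ya by (auto intro: le_neq_implies_less)
  have "0 < x" if "s \<noteq> North"
    using that N above by (metis gr0I)
  then show "card C < r y" if "s \<noteq> North"
    using that free_column_pos_iff[OF C] by (simp add: x_def)
  let ?T = "T - {(x, y)}" and ?C = "exhaust s x C" and ?y = "next_row s y"
  have "?y \<le> v \<and> v \<le> a \<and> u \<le> r v \<and> u \<notin> ?C" if "(u, v) \<in> ?T" for u v
  proof -
    have uv: "(u, v) \<in> T" "before (x, y) (u, v)" using first(2)[OF that] that by auto
    have "?y \<le> v"
    proof (cases "v = y")
      case True
      then have "s = East" using uv E by (auto simp: before_def)
      then show ?thesis using True by (simp add: next_row_def)
    next
      case False
      then show ?thesis using TD(1)[OF uv(1)] by (simp add: next_row_def)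
    qed
    moreover have "u \<notin> ?C"
      using TD(4)[OF uv(1)] uv N by (auto simp: exhaust_def before_def)
    ultimately show ?thesis using TD(2,3)[OF uv(1)] by simp
  qed
  moreover have "\<exists>u. (u, v) \<in> ?T" if v: "?y \<le> v" "v \<le> a" for v
  proof (cases "v = y")
    case True
    then have "s = East" using v(1) by (auto simp: next_row_def split: if_splits)
    then show ?thesis using E True by auto
  next
    case False
    then show ?thesis using TD(7)[of v] v by (auto simp: next_row_def split: if_splits)
  qed
  moreover have "\<exists>v. (u, v) \<in> ?T" if u: "u \<le> b" "u \<notin> ?C" for u
  proof (cases "u = x")
    case True
    then have "s = North" using u by (auto simp: exhaust_def split: if_splits)
    then show ?thesis using N True by auto
  next
    case False
    then show ?thesis using TD(8)[of u] u by (auto simp: exhaust_def split: if_splits)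
  qed
  moreover have "(0, a) \<in> ?T" using nr TD(6) by auto
  moreover have "r z < x'" if "(x, z) \<in> ?T" "(x', z') \<in> ?T" "x < x'" "z < z'" for x z x' z'
    using TD(5)[of x z x' z'] that by blast
  ultimately show "?T \<in> partial_trees ?C ?y"
    unfolding partial_trees_def by blast
qed

text \<open>This inverts the removal. The state reached by \<open>s\<close> dictates the label: it
  tells whether column \<open>x\<close> and row \<open>y\<close> must still be met by
  \<open>T\<close>.\<close>

lemma partial_tree_insert_first:
  assumes C: "exhaustible C y"
  defines "x \<equiv> free_column C y"
  assumes row: "s \<noteq> East \<Longrightarrow> y < a"
    and T: "T \<in> partial_trees (exhaust s x C) (next_row s y)"
  shows "(x, y) \<notin> T" "insert (x, y) T \<in> partial_trees C y" "label (insert (x, y) T) (x, y) = s"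
proof -
  note TD = partial_treesD[OF T] and x = free_column[OF C, folded x_def]
  have ya: "y \<le> a" using C by (simp add: exhaustible_def)
  have C_sub: "C \<subseteq> exhaust s x C" by (auto simp: exhaust_def)
  have y_le: "y \<le> next_row s y" by (simp add: next_row_def)
  show nin: "(x, y) \<notin> T"
    using TD(1)[of x y] TD(4)[of x y] by (auto simp: exhaust_def next_row_def split: if_splits)
  let ?T = "insert (x, y) T"
  have "y \<le> v \<and> v \<le> a \<and> u \<le> r v \<and> u \<notin> C" if "(u, v) \<in> ?T" for u v
    using that ya x(1,2) TD(1-4)[of u v] C_sub y_le by auto
  moreover have "r v < u'" if uv: "(u, v) \<in> ?T" "(u', v') \<in> ?T" "u < u'" "v < v'" for u v u' v'
  proof (cases "(u, v) = (x, y)")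
    case True
    then have "(u', v') \<in> T" using uv by auto
    then have "u' \<notin> C" using TD(4) C_sub by blast
    \<comment> \<open>By the maximality of \<open>x\<close>, every free column to its right lies
      beyond \<open>r y\<close>, so the new point is compatible with all points northeast of
      it.\<close>
    then have "\<not> u' \<le> r y" using x(3)[of u'] True uv by auto
    then show ?thesis using True by simp
  next
    case False
    then have 1: "(u, v) \<in> T" using uv by auto
    then have "(u', v') \<noteq> (x, y)" using TD(1) y_le uv by fastforce
    then show ?thesis using TD(5)[OF 1] uv by blast
  qed
  moreover have "\<exists>u. (u, v) \<in> ?T" if "y \<le> v" "v \<le> a" for v
  proof (cases "v = y")
    case False
    then show ?thesis using TD(7)[of v] that by (auto simp: next_row_def split: if_splits)
  qed auto
  moreover have "\<exists>v. (u, v) \<in> ?T" if "u \<le> b" "u \<notin> C" for u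
  proof (cases "u = x")
    case False
    then show ?thesis using TD(8)[of u] that by (auto simp: exhaust_def split: if_splits)
  qed auto
  moreover have "(0, a) \<in> ?T" using TD(6) by simp
  ultimately show "?T \<in> partial_trees C y"
    unfolding partial_trees_def by blast
  show "label ?T (x, y) = s"
  proof (cases s)
    case North
    then obtain v where v: "(x, v) \<in> T"
      using TD(8)[of x] x(1,2) r_le[OF ya] by (auto simp: exhaust_def)
    have "y < v" using TD(1)[OF v] North by (simp add: next_row_def)
    then show ?thesis using v North by (auto simp: label_def)
  next
    case East
    then obtain u where u: "(u, y) \<in> T"
      using TD(7)[of y] ya by (auto simp: next_row_def)
    \<comment> \<open>Maximality gives \<open>u \<le> x\<close>, and \<open>u = x\<close> is
      impossible because East has put \<open>x\<close> among the exhausted columns.\<close>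
    have "u < x" using TD(3,4)[OF u] x(3)[of u] East by (auto simp: exhaust_def)
    moreover have "(x, v) \<notin> T" for v
      using TD(4)[of x v] East by (auto simp: exhaust_def)
    ultimately show ?thesis using u East by (auto simp: label_def)
  next
    case Diag
    then have "(x, v) \<notin> T" "(u, y) \<notin> T" for u v
      using TD(4)[of x v] TD(1)[of u y] by (auto simp: exhaust_def next_row_def)
    then show ?thesis using Diag by (auto simp: label_def)
  qed
qed

section \<open>Induction along the word\<close>

lemma partial_tree_word_Cons:
  assumes C: "exhaustible C y" and T: "T \<in> partial_trees C y" and ne: "(free_column C y, y) \<noteq> (0, a)"
  shows "tree_word a b T = label T (free_column C y, y) # tree_word a b (T - {(free_column C y, y)})"
proof (rule tree_word_first[OF _ _ ne])
  show "(free_column C y, y) \<in> set (grid a b)"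
    using C free_column(1)[OF C] r_le[of y] by (auto simp: set_grid exhaustible_def)
qed (use partial_tree_first[OF C T] in auto)

lemma tree_word_root: "tree_word a b {(0, a)} = []"
  by (simp add: tree_word_def)

lemma word_above_tree_word:
  assumes "exhaustible C y" "T \<in> partial_trees C y"
  shows "word_above (card C) y (tree_word a b T)"
  using assms
proof (induction "tree_word a b T" arbitrary: C y T)
  case Nil
  note TD = partial_treesD[OF Nil.prems(2)]
  \<comment> \<open>Any other partial tree has a first point different from the root, which would
    contribute a letter.\<close>
  have T: "T = {(0, a)}"
    using Nil.hyps partial_tree_remove_first(1)[OF Nil.prems]
      partial_tree_word_Cons[OF Nil.prems] by fastforce
  have "y = a" using TD(7)[of y] T Nil.prems(1) by (auto simp: exhaustible_def)
  \<comment> \<open>The root meets column 0 only, so every other column must be exhausted.\<close>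
  have "{1..b} \<subseteq> C" using TD(8) T by fastforce
  then have "C = {1..b}"
    using Nil.prems(1) \<open>y = a\<close> r_top by (auto simp: exhaustible_def)
  then show ?case using \<open>y = a\<close> Nil.hyps[symmetric] by simp
next
  case (Cons s w)
  then have ne: "T \<noteq> {(0, a)}" using tree_word_root by auto
  note rem = partial_tree_remove_first[OF Cons.prems ne]
  have w: "s = label T (free_column C y, y)" "w = tree_word a b (T - {(free_column C y, y)})"
    using partial_tree_word_Cons[OF Cons.prems rem(1)] Cons.hyps(2) by simp_all
  have ex: "exhaustible (exhaust s (free_column C y) C) (next_row s y)"
    using exhaustible_next[OF Cons.prems(1)] rem(2,3) w(1) by blast
  have "word_above (card (exhaust s (free_column C y) C)) (next_row s y) w"
    using Cons.hyps(1)[OF w(2) ex] rem(4) w by simp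
  then show ?case
    using rem(2,3) card_exhaust[OF Cons.prems(1)] w(1) unfolding Cons.hyps(2)[symmetric] by simp
qed

text \<open>The first point depends only on \<open>C\<close> and \<open>y\<close>, so it is common
  to both trees; the common first letter then leads both remainders to the same state.\<close>

lemma tree_word_inj:
  assumes "exhaustible C y" "T \<in> partial_trees C y" "T' \<in> partial_trees C y"
    and "tree_word a b T = tree_word a b T'"
  shows "T = T'"
  using assms
proof (induction "tree_word a b T" arbitrary: C y T T')
  case Nil
  have "S = {(0, a)}" if "S \<in> partial_trees C y" "tree_word a b S = []" for S
    using that partial_tree_remove_first(1)[OF Nil.prems(1) that(1)]
      partial_tree_word_Cons[OF Nil.prems(1) that(1)] by fastforce
  then show ?case using Nil by metis
next
  case (Cons s w)
  let ?p = "(free_column C y, y)"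
  have *: "?p \<noteq> (0, a) \<and> s = label S ?p \<and> w = tree_word a b (S - {?p}) \<and>
      S - {?p} \<in> partial_trees (exhaust s (free_column C y) C) (next_row s y) \<and>
      exhaustible (exhaust s (free_column C y) C) (next_row s y)"
    if "S \<in> partial_trees C y" "tree_word a b S = s # w" for S
  proof -
    have ne: "S \<noteq> {(0, a)}" using that(2) tree_word_root by auto
    note rem = partial_tree_remove_first[OF Cons.prems(1) that(1) ne]
    have w: "s = label S ?p" "w = tree_word a b (S - {?p})"
      using partial_tree_word_Cons[OF Cons.prems(1) that(1) rem(1)] that(2) by simp_all
    then show ?thesis
      using rem exhaustible_next[OF Cons.prems(1), of s] by simp
  qed
  note T = *[OF Cons.prems(2) Cons.hyps(2)[symmetric]]
  note T' = *[OF Cons.prems(3) Cons.prems(4)[folded Cons.hyps(2), symmetric]]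
  have "T - {?p} = T' - {?p}"
    using T T' by (intro Cons.hyps(1)) auto
  moreover have "?p \<in> T" "?p \<in> T'"
    using partial_tree_first(1)[OF Cons.prems(1)] Cons.prems(2,3) by auto
  ultimately show ?case by blast
qed

text \<open>The tree is built from the end of the word: a tree for the tail, taken at the state
  after the first letter, receives the first point of the current state.\<close>

lemma tree_word_surj:
  assumes "exhaustible C y" "word_above (card C) y w"
  shows "\<exists>T\<in>partial_trees C y. tree_word a b T = w"
  using assms
proof (induction w arbitrary: C y)
  case Nil
  then have y: "y = a" and sub: "C \<subseteq> {1..b}" and card: "card C = card {1..b}"
    using r_top by (auto simp: exhaustible_def)
  have "C = {1..b}" using card_subset_eq[OF _ sub card] by simp
  then have "{(0, a)} \<in> partial_trees C y"
    using y by (auto simp: partial_trees_def)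
  then show ?case using tree_word_root by blast
next
  case (Cons s w)
  let ?x = "free_column C y" let ?C = "exhaust s ?x C"
  have s: "s \<noteq> East \<Longrightarrow> y < a" "s \<noteq> North \<Longrightarrow> card C < r y"
    and w: "word_above (card ?C) (next_row s y) w"
    using Cons.prems card_exhaust[OF Cons.prems(1)] by auto
  obtain T where T: "T \<in> partial_trees ?C (next_row s y)" "tree_word a b T = w"
    using Cons.IH[OF exhaustible_next[OF Cons.prems(1) s] w] by blast
  note ins = partial_tree_insert_first[OF Cons.prems(1) s(1) T(1)]
  have "(?x, y) \<noteq> (0, a)" using ins(1) partial_treesD(6)[OF T(1)] by auto
  then have "tree_word a b (insert (?x, y) T) = s # w"
    using partial_tree_word_Cons[OF Cons.prems(1) ins(2)] ins(1,3) T(2) by simp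
  then show ?case using ins(2) by blast
qed

lemma bij_betw_tree_word:
  "bij_betw (tree_word a b) (partial_trees {} 0) {w. word_above 0 0 w}"
proof -
  have "exhaustible {} 0" by (simp add: exhaustible_def)
  from word_above_tree_word[OF this] tree_word_inj[OF this] tree_word_surj[OF this]
  show ?thesis unfolding bij_betw_def inj_on_def by force
qed

end

section \<open>The region weakly above a lattice path\<close>

lemma closed_segment_dir:
  "closed_segment (embed p) (embed (p + dir s)) =
    (\<lambda>t. (real (fst p) + t * real (fst (dir s)), real (snd p) + t * real (snd (dir s)))) ` {0..1}"
  unfolding closed_segment_def embed_def
  by (auto simp: algebra_simps image_iff)

lemma trace_from_start: "embed p \<in> trace_from p w"
  by (cases w) auto

lemma trace_from_end: "embed (p + endpoint w) \<in> trace_from p w"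
proof (induction w arbitrary: p)
  case (Cons s w)
  then show ?case using Cons.IH[of "p + dir s"] by (simp add: endpoint_def add.assoc)
qed (simp add: endpoint_def)

lemma trace_from_ge:
  "(u, v) \<in> trace_from p w \<Longrightarrow> real (fst p) \<le> u \<and> real (snd p) \<le> v"
proof (induction w arbitrary: p)
  case (Cons s w)
  then show ?case
    using Cons.IH[of "p + dir s"] by (fastforce simp: closed_segment_dir)
qed (simp add: embed_def)

lemma trace_from_le:
  "(u, v) \<in> trace_from p w \<Longrightarrow>
    u \<le> real (fst (p + endpoint w)) \<and> v \<le> real (snd (p + endpoint w))"
proof (induction w arbitrary: p)
  case (Cons s w)
  have 1: "u \<le> real (fst p + fst (dir s))" "v \<le> real (snd p + snd (dir s))"
    if "(u, v) \<in> closed_segment (embed p) (embed (p + dir s))"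
    using that by (auto simp: closed_segment_dir mult_left_le_one_le)
  show ?case
    using Cons 1 by (fastforce simp: endpoint_def add.assoc)
qed (simp add: embed_def endpoint_def)

text \<open>The path passes every abscissa between its start and \<open>u\<close> before reaching
  \<open>(u, v)\<close>, and its height never decreases.\<close>

lemma trace_from_left:
  assumes "set w \<subseteq> {North, East}" "(u, v) \<in> trace_from p w" "real (fst p) \<le> u'" "u' \<le> u"
  shows "\<exists>v'\<le>v. (u', v') \<in> trace_from p w"
  using assms
proof (induction w arbitrary: p)
  case Nil
  then show ?case by (auto simp: embed_def)
next
  case (Cons s w)
  let ?S = "closed_segment (embed p) (embed (p + dir s))"
  consider (N) "s = North" | (E) "s = East" using Cons.prems(1) by auto
  then show ?case
  proof cases
    case N
    show ?thesis
    proof (cases "(u, v) \<in> ?S")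
      case True
      then have "u' = u" using Cons.prems N unfolding closed_segment_dir by auto
      then show ?thesis using Cons.prems by auto
    next
      case False
      then show ?thesis using Cons.IH[of "p + dir s"] Cons.prems N by auto
    qed
  next
    case E
    \<comment> \<open>If \<open>u'\<close> falls within the first east step, the point there has the
      height of the start, the least on the whole trace.\<close>
    have seg: "(u', real (snd p)) \<in> ?S" if "u' \<le> real (fst p) + 1"
      using that Cons.prems(3) E unfolding closed_segment_dir
      by (auto simp: image_iff intro!: bexI[of _ "u' - real (fst p)"])
    show ?thesis
    proof (cases "u' \<le> real (fst p) + 1")
      case True
      then show ?thesis using seg trace_from_ge[OF Cons.prems(2)] by auto
    next
      case False
      then have "(u, v) \<notin> ?S" using Cons.prems E unfolding closed_segment_dir by auto
      then show ?thesis using Cons.IH[of "p + dir s"] Cons.prems E False by auto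
    qed
  qed
qed

text \<open>Strictly between two integer abscissae the trace runs inside one east step, whose right
  end is a lattice point of the same height.\<close>

lemma trace_from_integral:
  assumes "set w \<subseteq> {North, East}" "(u, v) \<in> trace_from p w" "real n < u" "u < real (Suc n)"
  shows "\<exists>m. v = real m \<and> embed (Suc n, m) \<in> trace_from p w"
  using assms
proof (induction w arbitrary: p)
  case Nil
  then show ?case by (auto simp: embed_def)
next
  case (Cons s w)
  let ?S = "closed_segment (embed p) (embed (p + dir s))"
  show ?case
  proof (cases "(u, v) \<in> ?S")
    case False
    then show ?thesis using Cons.IH[of "p + dir s"] Cons.prems by auto
  next
    case True
    have "s \<noteq> North" using True Cons.prems(3,4) unfolding closed_segment_dir by auto
    then have s: "s = East" using Cons.prems(1) by auto
    then obtain t where t: "0 \<le> t" "t \<le> 1" "u = real (fst p) + t" "v = real (snd p)"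
      using True unfolding closed_segment_dir by auto
    have "fst p = n" using t Cons.prems(3,4) by linarith
    then have "embed (Suc n, snd p) \<in> ?S" using s by (cases p) simp
    then show ?thesis using t(4) by auto
  qed
qed

lemma region_mono:
  assumes \<nu>: "lattice_path \<nu>" and uv: "(u, v) \<in> region \<nu>"
    and le: "0 \<le> u'" "u' \<le> u" "v \<le> v'" "v' \<le> real (height \<nu>)"
  shows "(u', v') \<in> region \<nu>"
proof -
  obtain y where "(u, y) \<in> trace \<nu>" "y \<le> v" using uv by (auto simp: region_def)
  moreover from this obtain y' where "y' \<le> y" "(u', y') \<in> trace \<nu>"
    using trace_from_left[of \<nu> u y "(0, 0)" u'] \<nu> le by (auto simp: trace_def lattice_path_def)
  ultimately show ?thesis using uv le by (force simp: region_def)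
qed

text \<open>The centre of a unit cell forces the lower right corner of the cell into the region:
  below the centre \<nu> runs along a horizontal unit segment at integer height.\<close>

lemma region_diag:
  assumes \<nu>: "lattice_path \<nu>" and "(real x + 1 / 2, real y + 1 / 2) \<in> region \<nu>"
  shows "embed (Suc x, y) \<in> region \<nu>"
proof -
  obtain v where v: "(real x + 1 / 2, v) \<in> trace \<nu>" "v \<le> real y + 1 / 2"
    using assms(2) by (auto simp: region_def)
  then obtain m where m: "v = real m" "embed (Suc x, m) \<in> trace \<nu>"
    using trace_from_integral[of \<nu> "real x + 1 / 2" v "(0, 0)" x] \<nu>
    by (auto simp: trace_def lattice_path_def)
  \<comment> \<open>Doubling clears the fraction; an integer \<open>m\<close> at most
    \<open>y + 1/2\<close> is at most \<open>y\<close>.\<close>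
  have "real (2 * m) \<le> real (2 * y + 1)" using m(1) v(2) by simp
  then have "real m \<le> real y" unfolding of_nat_le_iff by simp
  moreover have "real (Suc x) \<le> real (width \<nu>)"
    using trace_from_le[of _ _ "(0, 0)" \<nu>] m(2) unfolding trace_def embed_def by fastforce
  moreover have "real y \<le> real (height \<nu>)" using assms(2) by (simp add: region_def)
  ultimately show ?thesis using m(2) unfolding region_def embed_def by auto
qed

section \<open>Lattice points of the region\<close>

definition row_end :: "step list \<Rightarrow> nat \<Rightarrow> nat" where
  "row_end \<nu> y = Max {x. embed (x, y) \<in> region \<nu>}"

lemma embed_in_region_iff:
  assumes \<nu>: "lattice_path \<nu>"
  shows "embed (x, y) \<in> region \<nu> \<longleftrightarrow> y \<le> height \<nu> \<and> x \<le> row_end \<nu> y"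
proof
  let ?X = "{x. embed (x, y) \<in> region \<nu>}"
  have "?X \<subseteq> {..width \<nu>}" by (auto simp: region_def embed_def)
  then have fin: "finite ?X" using finite_subset by blast
  show "y \<le> height \<nu> \<and> x \<le> row_end \<nu> y" if "embed (x, y) \<in> region \<nu>"
    using that Max_ge[OF fin, of x] by (auto simp: row_end_def region_def embed_def)
  show "embed (x, y) \<in> region \<nu>" if le: "y \<le> height \<nu> \<and> x \<le> row_end \<nu> y"
  proof -
    \<comment> \<open>The origin is on \<nu>, so column 0 is always in the region; the set is
      nonempty and its maximum is attained.\<close>
    have "embed (0, y) \<in> region \<nu>"
      using trace_from_start[of "(0, 0)" \<nu>] le by (force simp: region_def embed_def trace_def)
    then have "row_end \<nu> y \<in> ?X" unfolding row_end_def by (intro Max_in fin) auto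
    then show ?thesis
      using region_mono[OF \<nu>, of "real (row_end \<nu> y)" "real y" "real x" "real y"] le
      by (simp add: embed_def)
  qed
qed

lemma staircase_row_end:
  assumes \<nu>: "lattice_path \<nu>"
  shows "staircase (row_end \<nu>) (height \<nu>) (width \<nu>)"
proof
  show "row_end \<nu> y \<le> row_end \<nu> y'" if "y \<le> y'" "y' \<le> height \<nu>" for y y'
  proof -
    have "embed (row_end \<nu> y, y) \<in> region \<nu>" using embed_in_region_iff[OF \<nu>] that by simp
    then have "embed (row_end \<nu> y, y') \<in> region \<nu>"
      using region_mono[OF \<nu>] that by (simp add: embed_def)
    then show ?thesis using embed_in_region_iff[OF \<nu>] by simp
  qed
  show "row_end \<nu> (height \<nu>) = width \<nu>"
  proof (rule antisym)
    have "embed (row_end \<nu> (height \<nu>), height \<nu>) \<in> region \<nu>"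
      using embed_in_region_iff[OF \<nu>] by simp
    then show "row_end \<nu> (height \<nu>) \<le> width \<nu>" by (simp add: region_def embed_def)
    have "embed (endpoint \<nu>) \<in> region \<nu>"
      using trace_from_end[of "(0, 0)" \<nu>]
      by (auto simp: region_def embed_def trace_def simp flip: zero_prod_def)
    then show "width \<nu> \<le> row_end \<nu> (height \<nu>)"
      using embed_in_region_iff[OF \<nu>, of "width \<nu>" "height \<nu>"] by simp
  qed
qed

text \<open>Every point of the rectangle is reached from its lower right corner by moving left and
  up, which stays in the region.\<close>

lemma rectangle_subset_region_iff:
  assumes \<nu>: "lattice_path \<nu>" and "strictly_southwest p q" "snd q \<le> height \<nu>"
  shows "rectangle p q \<subseteq> region \<nu> \<longleftrightarrow> fst q \<le> row_end \<nu> (snd p)"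
proof
  have le: "fst p < fst q" "snd p < snd q" using assms(2) by (auto simp: strictly_southwest_def)
  show "fst q \<le> row_end \<nu> (snd p)" if "rectangle p q \<subseteq> region \<nu>"
  proof -
    have "embed (fst q, snd p) \<in> rectangle p q" using le by (simp add: rectangle_def embed_def)
    then show ?thesis using that embed_in_region_iff[OF \<nu>] by blast
  qed
  show "rectangle p q \<subseteq> region \<nu>" if "fst q \<le> row_end \<nu> (snd p)"
  proof -
    have "embed (fst q, snd p) \<in> region \<nu>"
      using that embed_in_region_iff[OF \<nu>] le assms(3) by simp
    then show ?thesis
      using region_mono[OF \<nu>] le assms(3) by (fastforce simp: rectangle_def embed_def)
  qed
qed

text \<open>For East and Diag alike the test is the lower right corner of the unit cell at
  \<open>p\<close>: the midpoint of a diagonal forces it, and moving left and up from it gives the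
  segment.\<close>

lemma segment_subset_region_iff:
  assumes \<nu>: "lattice_path \<nu>" and p: "embed p \<in> region \<nu>" "snd (p + dir s) \<le> height \<nu>"
  shows "closed_segment (embed p) (embed (p + dir s)) \<subseteq> region \<nu> \<longleftrightarrow>
    (s \<noteq> North \<longrightarrow> fst p < row_end \<nu> (snd p))"
proof -
  obtain x y where xy: "p = (x, y)" by (cases p)
  show ?thesis
  proof (cases "s = North")
    case True
    then show ?thesis
      using region_mono[OF \<nu> p(1)[unfolded embed_def]] p(2) xy
      unfolding closed_segment_dir by auto
  next
    case False
    have "closed_segment (embed p) (embed (p + dir s)) \<subseteq> region \<nu> \<longleftrightarrow> embed (Suc x, y) \<in> region \<nu>"
      (is "?S \<subseteq> _ \<longleftrightarrow> _")
    proof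
      assume sub: "?S \<subseteq> region \<nu>"
      show "embed (Suc x, y) \<in> region \<nu>"
      proof (cases s)
        case East
        then have "embed (Suc x, y) \<in> ?S" using xy by simp
        then show ?thesis using sub by blast
      next
        case Diag
        then have "(real x + 1 / 2, real y + 1 / 2) \<in> ?S"
          using xy unfolding closed_segment_dir by (auto intro!: image_eqI[of _ _ "1 / 2"])
        then show ?thesis using sub region_diag[OF \<nu>] by blast
      qed (use False in simp)
    next
      assume "embed (Suc x, y) \<in> region \<nu>"
      note mono = region_mono[OF \<nu> this[unfolded embed_def]]
      show "?S \<subseteq> region \<nu>"
        using False p(2) xy unfolding closed_segment_dir by (cases s) (auto intro!: mono)
    qed
    then show ?thesis
      using embed_in_region_iff[OF \<nu>] False p(2) xy by (auto simp: Suc_le_eq)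
  qed
qed

section \<open>The paths and trees of \<nu> as words and partial trees\<close>

context
  fixes \<nu> :: "step list"
  assumes \<nu>: "lattice_path \<nu>"
begin

interpretation staircase "row_end \<nu>" "height \<nu>" "width \<nu>"
  by (rule staircase_row_end[OF \<nu>])

lemma trace_from_subset_region_iff:
  assumes "embed p \<in> region \<nu>"
  shows "p + endpoint w = endpoint \<nu> \<and> trace_from p w \<subseteq> region \<nu> \<longleftrightarrow> word_above (fst p) (snd p) w"
  using assms
proof (induction w arbitrary: p)
  case Nil
  have "endpoint [] = 0" by (simp add: endpoint_def)
  then show ?case using Nil by (auto simp: prod_eq_iff)
next
  case (Cons s w)
  let ?q = "p + dir s"
  have q: "fst ?q = (if s = North then fst p else Suc (fst p))" "snd ?q = next_row s (snd p)"
    by (cases s; simp add: next_row_def)+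
  have ep: "p + endpoint (s # w) = ?q + endpoint w" by (simp add: endpoint_def add.assoc)
  have p_le: "snd p \<le> height \<nu>" using Cons.prems embed_in_region_iff[OF \<nu>] by (cases p) auto
  have h: "snd ?q \<le> height \<nu> \<longleftrightarrow> (s \<noteq> East \<longrightarrow> snd p < height \<nu>)"
    using p_le unfolding q by (auto simp: next_row_def)
  have "p + endpoint (s # w) = endpoint \<nu> \<and> trace_from p (s # w) \<subseteq> region \<nu> \<longleftrightarrow>
    snd ?q \<le> height \<nu> \<and> closed_segment (embed p) (embed ?q) \<subseteq> region \<nu> \<and>
    ?q + endpoint w = endpoint \<nu> \<and> trace_from ?q w \<subseteq> region \<nu>"
  proof -
    \<comment> \<open>Coordinates only grow along a path, so the final height bounds that of
      \<open>?q\<close>; the criterion for a single step needs this bound.\<close>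
    have "snd ?q \<le> height \<nu>" if "?q + endpoint w = endpoint \<nu>"
      unfolding that[symmetric] by simp
    then show ?thesis unfolding ep by auto
  qed
  also have "\<dots> \<longleftrightarrow> snd ?q \<le> height \<nu> \<and> closed_segment (embed p) (embed ?q) \<subseteq> region \<nu> \<and>
    word_above (fst ?q) (snd ?q) w"
    \<comment> \<open>The segment contains its end \<open>embed ?q\<close>, which gives the premise
      of the induction hypothesis.\<close>
    using Cons.IH[of ?q] by blast
  also have "\<dots> \<longleftrightarrow> word_above (fst p) (snd p) (s # w)"
    using segment_subset_region_iff[OF \<nu> Cons.prems, of s] h unfolding q by auto
  finally show ?case .
qed

lemma schroeder_paths_eq: "schroeder_paths \<nu> = {w. word_above 0 0 w}"
proof -
  have "embed (0, 0) \<in> region \<nu>" using embed_in_region_iff[OF \<nu>] by simp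
  from trace_from_subset_region_iff[OF this] show ?thesis
    by (simp add: schroeder_paths_def trace_def flip: zero_prod_def)
qed

text \<open>Incompatibility is symmetric, so it suffices to consider pairs with \<open>p\<close>
  southwest of \<open>q\<close>, for which the rectangle condition becomes the corner
  condition.\<close>

lemma schroeder_trees_eq: "schroeder_trees \<nu> = partial_trees {} 0"
proof -
  have "pairwise (\<lambda>p q. \<not> incompatible \<nu> p q) T \<longleftrightarrow>
      (\<forall>x z x' z'. (x, z) \<in> T \<longrightarrow> (x', z') \<in> T \<longrightarrow> x < x' \<longrightarrow> z < z' \<longrightarrow> row_end \<nu> z < x')"
    if T: "\<forall>p\<in>T. embed p \<in> region \<nu>" for T
  proof -
    have rect: "rectangle p q = rectangle q p" for p q
      by (simp add: rectangle_def min.commute max.commute)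
    have "pairwise (\<lambda>p q. \<not> incompatible \<nu> p q) T \<longleftrightarrow>
        (\<forall>p\<in>T. \<forall>q\<in>T. strictly_southwest p q \<longrightarrow> \<not> rectangle p q \<subseteq> region \<nu>)"
      unfolding pairwise_def incompatible_def using rect
      by (metis strictly_southwest_def less_irrefl)
    also have "\<dots> \<longleftrightarrow> (\<forall>p\<in>T. \<forall>q\<in>T. strictly_southwest p q \<longrightarrow> row_end \<nu> (snd p) < fst q)"
    proof -
      have "snd q \<le> height \<nu>" if "q \<in> T" for q
        using T that embed_in_region_iff[OF \<nu>, of "fst q" "snd q"] by auto
      then show ?thesis
        using rectangle_subset_region_iff[OF \<nu>] by (meson not_le)
    qed
    finally show ?thesis
      unfolding Ball_def split_paired_All strictly_southwest_def by auto
  qed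
  moreover have "(\<forall>p\<in>T. embed p \<in> region \<nu>) \<longleftrightarrow>
      (\<forall>x z. (x, z) \<in> T \<longrightarrow> 0 \<le> z \<and> z \<le> height \<nu> \<and> x \<le> row_end \<nu> z \<and> x \<notin> {})" for T
    using embed_in_region_iff[OF \<nu>] by auto
  ultimately show ?thesis
    unfolding schroeder_trees_def partial_trees_def root_def by auto
qed

end

lemma \<phi>_eq_tree_word: "\<phi> \<nu> = tree_word (height \<nu>) (width \<nu>)"
proof
  fix T
  \<comment> \<open>The list comprehension unfolds to a concatenation of conditional singletons,
    which is a filter on each row.\<close>
  have row: "concat (map (\<lambda>x. if (x, y) \<in> S then [(x, y)] else []) xs) =
      filter (\<lambda>p. p \<in> S) (map (\<lambda>x. (x, y)) xs)"
    for S and y :: nat and xs :: "nat list"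
    by (induction xs) auto
  have "nonroot_points \<nu> T = filter (\<lambda>p. p \<in> T - {root \<nu>}) (grid (height \<nu>) (width \<nu>))"
    unfolding nonroot_points_def grid_def filter_concat map_map comp_def row ..
  then show "\<phi> \<nu> T = tree_word (height \<nu>) (width \<nu>) T"
    by (simp add: \<phi>_def tree_word_def root_def)
qed

theorem theorem3p11:
  fixes \<nu> :: "step list" and a b :: nat
  assumes "lattice_path \<nu>"
    and "endpoint \<nu> = (b, a)"
  shows "bij_betw (\<phi> \<nu>) (schroeder_trees \<nu>) (schroeder_paths \<nu>)"
  using staircase.bij_betw_tree_word[OF staircase_row_end[OF assms(1)]]
  unfolding schroeder_paths_eq[OF assms(1)] schroeder_trees_eq[OF assms(1)] \<phi>_eq_tree_word .

end
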